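(* Let $\langle\mathrm{Proc},\Sigma,\to\rangle$ be a labelled transition system. Assume that $\Sigma$ is finite and contains at least one action, and that $\mathrm{Proc}$ contains at least one deadlocked process and at least one non-deadlocked process. Let $D=\{p\in\mathrm{Proc}\mid I(p)=\varnothing\}$ be the set of deadlocked processes. Then $D\in\tau^{\mathrm{fin}}_{\mathrm{bis}}$ and $\mathrm{Proc}\setminus D\in\tau^{\mathrm{fin}}_{\mathrm{bis}}$, so $D$ is clopen in $\tau^{\mathrm{fin}}_{\mathrm{bis}}$. However, $D\notin\tau_{\mathrm{sim}}$. Consequently, $\tau^{\mathrm{fin}}_{\mathrm{bis}}\neq\tau_{\mathrm{sim}}$.
   Context: A labelled transition system is $\langle \mathrm{Proc},\Sigma,\to\rangle$ with $\to\subseteq \mathrm{Proc}\times\Sigma\times\mathrm{Proc}$. For a state $p$, $I(p)$ is the set of actions $a\in\Sigma$ such that $p\xrightarrow{a}p'$ for some $p'$; $p$ is deadlocked if $I(p)=\varnothing$. Finite loop-free processes: $\mathrm{Proc}_F$ is the set of terms generated by $q::=0\mid a.q\mid q+q$ with $a\in\Sigma$. Transitions: $q\xrightarrow{a}_F q'$ iff $q=a.q'$, or $q=q_1+q_2$ and ($q_1\xrightarrow{a}_F q'$ or $q_2\xrightarrow{a}_F q'$); $0$ has no transitions. Simulation topology: $R\subseteq\mathrm{Proc}_F\times\mathrm{Proc}$ is a simulation if whenever $(q,p)\in R$ and $q\xrightarrow{a}_F q'$, there is $p'\in\mathrm{Proc}$ with $p\xrightarrow{a}p'$ and $(q',p')\in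 R$. Write $q\sqsubseteq_S p$ if $(q,p)\in R$ for some simulation $R$. $O(q)=\{p\in\mathrm{Proc}\mid q\sqsubseteq_S p\}$, and $\tau_{\mathrm{sim}}$ is the topology on $\mathrm{Proc}$ generated by the basis $\{O(q)\mid q\in\mathrm{Proc}_F\}$. Finite-depth bisimulation topology: $\sim_k$ is defined inductively between processes of (possibly different) labelled transition systems over $\Sigma$: $x\sim_0 y$ always; $x\sim_{k+1}y$ iff (i) whenever $x\xrightarrow{a}x'$ there is $y'$ with $y\xrightarrow{a}y'$ and $x'\sim_k y'$, and (ii) whenever $y\xrightarrow{a}y'$ there is $x'$ with $x\xrightarrow{a}x'$ and $x'\sim_k y'$. For $q\in\mathrm{Proc}_F$ and $k\in\mathbb N$ ($0\in\mathbb N$), $O^k_{\mathrm{bis}}(q)=\{p\in\mathrm{Proc}\mid q\sim_k p\}$, and $\tau^{\mathrm{fin}}_{\mathrm{bis}}$ is the topology on $\mathrm{Proc}$ generated by the basis $\{O^k_{\mathrm{bis}}(q)\mid q\in\mathrm{Proc}_F,\ k\in\mathbb N\}$. *)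

theory Defs
  imports "HOL-Analysis.Analysis"
begin

locale lts =
  fixes Proc :: "'s set" and Act :: "'a set" and Tr :: "('s \<times> 'a \<times> 's) set"
  assumes Tr_subset: "Tr \<subseteq> Proc \<times> Act \<times> Proc"

definition initials :: "('s \<times> 'a \<times> 's) set \<Rightarrow> 's \<Rightarrow> 'a set" where
  "initials Tr p = {a. \<exists>p'. (p, a, p') \<in> Tr}"

definition deadlocked :: "('s \<times> 'a \<times> 's) set \<Rightarrow> 's \<Rightarrow> bool" where
  "deadlocked Tr p \<longleftrightarrow> initials Tr p = {}"

definition deadlocked_set :: "'s set \<Rightarrow> ('s \<times> 'a \<times> 's) set \<Rightarrow> 's set" where
  "deadlocked_set Proc Tr = {p \<in> Proc. deadlocked Tr p}"


datatype 'a fproc = Stop | Pre 'a "'a fproc" | Plus "'a fproc" "'a fproc"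

text \<open>The raw terms range over the whole type of labels; the process terms over the alphabet
  \<open>Act\<close> are singled out by the grammar. They are closed under transitions (see
  \<open>lts_fproc\<close> below).\<close>

inductive_set ProcF :: "'a set \<Rightarrow> 'a fproc set" for Act :: "'a set" where
  "Stop \<in> ProcF Act"
| "a \<in> Act \<Longrightarrow> q \<in> ProcF Act \<Longrightarrow> Pre a q \<in> ProcF Act"
| "q1 \<in> ProcF Act \<Longrightarrow> q2 \<in> ProcF Act \<Longrightarrow> Plus q1 q2 \<in> ProcF Act"

inductive_set transF :: "('a fproc \<times> 'a \<times> 'a fproc) set" where
  "(Pre a q, a, q) \<in> transF"
| "(q1, a, q') \<in> transF \<Longrightarrow> (Plus q1 q2, a, q') \<in> transF"
| "(q2, a, q') \<in> transF \<Longrightarrow> (Plus q1 q2, a, q') \<in> transF"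


definition simulation ::
    "'s set \<Rightarrow> 'a set \<Rightarrow> ('s \<times> 'a \<times> 's) set \<Rightarrow> ('a fproc \<times> 's) set \<Rightarrow> bool" where
  "simulation Proc Act Tr R \<longleftrightarrow> R \<subseteq> ProcF Act \<times> Proc \<and>
     (\<forall>q p a q'. (q, p) \<in> R \<longrightarrow> (q, a, q') \<in> transF \<longrightarrow>
        (\<exists>p'\<in>Proc. (p, a, p') \<in> Tr \<and> (q', p') \<in> R))"

definition simulated_by ::
    "'s set \<Rightarrow> 'a set \<Rightarrow> ('s \<times> 'a \<times> 's) set \<Rightarrow> 'a fproc \<Rightarrow> 's \<Rightarrow> bool" where
  "simulated_by Proc Act Tr q p \<longleftrightarrow> (\<exists>R. simulation Proc Act Tr R \<and> (q, p) \<in> R)"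

definition O_sim ::
    "'s set \<Rightarrow> 'a set \<Rightarrow> ('s \<times> 'a \<times> 's) set \<Rightarrow> 'a fproc \<Rightarrow> 's set" where
  "O_sim Proc Act Tr q = {p \<in> Proc. simulated_by Proc Act Tr q p}"

definition tau_sim :: "'s set \<Rightarrow> 'a set \<Rightarrow> ('s \<times> 'a \<times> 's) set \<Rightarrow> 's topology" where
  "tau_sim Proc Act Tr =
     topology_generated_by {O_sim Proc Act Tr q | q. q \<in> ProcF Act}"


primrec bisim_k ::
    "('s \<times> 'a \<times> 's) set \<Rightarrow> ('t \<times> 'a \<times> 't) set \<Rightarrow> nat \<Rightarrow> 's \<Rightarrow> 't \<Rightarrow> bool" where
  "bisim_k T1 T2 0 x y \<longleftrightarrow> True"
| "bisim_k T1 T2 (Suc k) x y \<longleftrightarrow>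
     (\<forall>a x'. (x, a, x') \<in> T1 \<longrightarrow> (\<exists>y'. (y, a, y') \<in> T2 \<and> bisim_k T1 T2 k x' y')) \<and>
     (\<forall>a y'. (y, a, y') \<in> T2 \<longrightarrow> (\<exists>x'. (x, a, x') \<in> T1 \<and> bisim_k T1 T2 k x' y'))"

definition O_bis ::
    "'s set \<Rightarrow> ('s \<times> 'a \<times> 's) set \<Rightarrow> nat \<Rightarrow> 'a fproc \<Rightarrow> 's set" where
  "O_bis Proc Tr k q = {p \<in> Proc. bisim_k transF Tr k q p}"

definition tau_bis_fin :: "'s set \<Rightarrow> 'a set \<Rightarrow> ('s \<times> 'a \<times> 's) set \<Rightarrow> 's topology" where
  "tau_bis_fin Proc Act Tr =
     topology_generated_by {O_bis Proc Tr k q | q k. q \<in> ProcF Act}"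


inductive_cases ProcF_PreE: "Pre a q \<in> ProcF Act"
inductive_cases ProcF_PlusE: "Plus q1 q2 \<in> ProcF Act"

lemma transF_ProcF:
  assumes "(q, a, q') \<in> transF" "q \<in> ProcF Act"
  shows "a \<in> Act \<and> q' \<in> ProcF Act"
  using assms
  by (induction q a q' rule: transF.induct) (auto elim: ProcF_PreE ProcF_PlusE)

lemma lts_fproc:
  "lts (ProcF Act) Act {(q, a, q') \<in> transF. q \<in> ProcF Act}"
  by unfold_locales (auto dest: transF_ProcF)

lemma transF_iff:
  "(q, a, q') \<in> transF \<longleftrightarrow>
     q = Pre a q' \<or> (\<exists>q1 q2. q = Plus q1 q2 \<and> ((q1, a, q') \<in> transF \<or> (q2, a, q') \<in> transF))"
  by (subst transF.simps) auto

text \<open>\<open>topology_generated_by\<close> takes a subbasis. The next facts show that both families are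
  bases of the topologies they generate, for the second one provided that \<open>Act\<close> is finite:
  the open sets are exactly the unions of members of the family.\<close>

lemma openin_generated_by_basis:
  assumes "\<And>A B x. A \<in> \<B> \<Longrightarrow> B \<in> \<B> \<Longrightarrow> x \<in> A \<Longrightarrow> x \<in> B \<Longrightarrow> \<exists>C\<in>\<B>. x \<in> C \<and> C \<subseteq> A \<inter> B"
  shows "openin (topology_generated_by \<B>) U \<longleftrightarrow> (\<exists>\<F>\<subseteq>\<B>. U = \<Union>\<F>)"
proof
  assume "openin (topology_generated_by \<B>) U"
  then have "generate_topology_on \<B> U" by (rule openin_topology_generated_by)
  then have "\<forall>x\<in>U. \<exists>C\<in>\<B>. x \<in> C \<and> C \<subseteq> U"
  proof (induction rule: generate_topology_on.induct)
    case (Int a b)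
    show ?case
    proof
      fix x assume x: "x \<in> a \<inter> b"
      obtain A where A: "A \<in> \<B>" "x \<in> A" "A \<subseteq> a" using Int.IH(1) x by blast
      obtain B where B: "B \<in> \<B>" "x \<in> B" "B \<subseteq> b" using Int.IH(2) x by blast
      show "\<exists>C\<in>\<B>. x \<in> C \<and> C \<subseteq> a \<inter> b"
        using assms[OF A(1) B(1) A(2) B(2)] A(3) B(3) by blast
    qed
  next
    case (UN K)
    show ?case
    proof
      fix x assume "x \<in> \<Union>K"
      then obtain k where k: "k \<in> K" "x \<in> k" by blast
      then obtain C where "C \<in> \<B>" "x \<in> C" "C \<subseteq> k" using UN.IH by blast
      then show "\<exists>C\<in>\<B>. x \<in> C \<and> C \<subseteq> \<Union>K" using k(1) by blast
    qed
  qed auto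
  then have "U = \<Union>{C \<in> \<B>. C \<subseteq> U}" by blast
  moreover have "{C \<in> \<B>. C \<subseteq> U} \<subseteq> \<B>" by blast
  ultimately show "\<exists>\<F>\<subseteq>\<B>. U = \<Union>\<F>" by (intro exI conjI)
next
  assume "\<exists>\<F>\<subseteq>\<B>. U = \<Union>\<F>"
  then obtain \<F> where F: "\<F> \<subseteq> \<B>" "U = \<Union>\<F>" by blast
  have "generate_topology_on \<B> A" if "A \<in> \<F>" for A
    using F(1) that by (blast intro: generate_topology_on.Basis)
  then show "openin (topology_generated_by \<B>) U"
    unfolding openin_topology_generated_by_iff F(2) by (rule generate_topology_on.UN)
qed

lemma simulated_by_iff:
  "simulated_by Proc Act Tr q p \<longleftrightarrow> q \<in> ProcF Act \<and> p \<in> Proc \<and>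
     (\<forall>a q'. (q, a, q') \<in> transF \<longrightarrow>
        (\<exists>p'\<in>Proc. (p, a, p') \<in> Tr \<and> simulated_by Proc Act Tr q' p'))"
  (is "?L q p \<longleftrightarrow> ?R q p")
proof -
  have 1: "?R q p" if "?L q p" for q p
  proof -
    from that obtain R where R: "simulation Proc Act Tr R" "(q, p) \<in> R"
      by (auto simp: simulated_by_def)
    have "\<exists>p'\<in>Proc. (p, a, p') \<in> Tr \<and> ?L q' p'" if t: "(q, a, q') \<in> transF" for a q'
    proof -
      obtain p' where "p' \<in> Proc" "(p, a, p') \<in> Tr" "(q', p') \<in> R"
        using R t unfolding simulation_def by meson
      then show ?thesis using R(1) unfolding simulated_by_def by blast
    qed
    moreover have "q \<in> ProcF Act" "p \<in> Proc" using R by (auto simp: simulation_def)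
    ultimately show ?thesis by simp
  qed
  have 2: "?L q p" if R: "?R q p"
  proof -
    let ?S = "insert (q, p) {(q, p). ?L q p}"
    have *: "?R u v" if "(u, v) \<in> ?S" for u v
      using that R 1[of u v] by (cases "(u, v) = (q, p)") auto
    have "simulation Proc Act Tr ?S"
      unfolding simulation_def
    proof (intro conjI allI impI)
      show "?S \<subseteq> ProcF Act \<times> Proc" using * by (intro subrelI) simp
      fix u v a u' assume "(u, v) \<in> ?S" and t: "(u, a, u') \<in> transF"
      from *[OF this(1)] t obtain v' where "v' \<in> Proc" "(v, a, v') \<in> Tr" "?L u' v'" by blast
      then show "\<exists>p'\<in>Proc. (v, a, p') \<in> Tr \<and> (u', p') \<in> ?S" by auto
    qed
    then show ?thesis unfolding simulated_by_def by blast
  qed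
  show ?thesis using 1 2 by blast
qed

lemma O_sim_Plus:
  assumes "q1 \<in> ProcF Act" "q2 \<in> ProcF Act"
  shows "O_sim Proc Act Tr (Plus q1 q2) = O_sim Proc Act Tr q1 \<inter> O_sim Proc Act Tr q2"
proof -
  have "simulated_by Proc Act Tr (Plus q1 q2) p \<longleftrightarrow>
      simulated_by Proc Act Tr q1 p \<and> simulated_by Proc Act Tr q2 p" for p
    using assms
    by (subst (1 2 3) simulated_by_iff) (auto simp: transF_iff[of "Plus q1 q2"] intro: ProcF.intros)
  then show ?thesis by (auto simp: O_sim_def)
qed

lemma openin_tau_sim:
  "openin (tau_sim Proc Act Tr) U \<longleftrightarrow>
     (\<exists>\<F>\<subseteq>{O_sim Proc Act Tr q | q. q \<in> ProcF Act}. U = \<Union>\<F>)"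
  unfolding tau_sim_def
proof (rule openin_generated_by_basis)
  fix A B x
  assume "A \<in> {O_sim Proc Act Tr q | q. q \<in> ProcF Act}"
    "B \<in> {O_sim Proc Act Tr q | q. q \<in> ProcF Act}" and x: "x \<in> A" "x \<in> B"
  then obtain q1 q2 where q: "q1 \<in> ProcF Act" "q2 \<in> ProcF Act"
    "A = O_sim Proc Act Tr q1" "B = O_sim Proc Act Tr q2" by blast
  then have "A \<inter> B = O_sim Proc Act Tr (Plus q1 q2)" "Plus q1 q2 \<in> ProcF Act"
    by (auto simp: O_sim_Plus intro: ProcF.intros)
  then show "\<exists>C\<in>{O_sim Proc Act Tr q | q. q \<in> ProcF Act}. x \<in> C \<and> C \<subseteq> A \<inter> B"
    using x by blast
qed

lemma topspace_tau_sim: "topspace (tau_sim Proc Act Tr) = Proc"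
proof -
  have "O_sim Proc Act Tr Stop = Proc"
    unfolding O_sim_def
    by (subst simulated_by_iff) (auto simp: transF_iff[of Stop] intro: ProcF.intros)
  then show ?thesis
    unfolding tau_sim_def topology_generated_by_topspace
    by (auto simp: O_sim_def intro: ProcF.intros)
qed

lemma topspace_tau_bis_fin: "topspace (tau_bis_fin Proc Act Tr) = Proc"
proof -
  have "O_bis Proc Tr 0 Stop = Proc" by (simp add: O_bis_def)
  moreover have "O_bis Proc Tr 0 Stop \<in> {O_bis Proc Tr k q | q k. q \<in> ProcF Act}"
    using ProcF.intros(1) by blast
  moreover have "O_bis Proc Tr k q \<subseteq> Proc" for k q by (auto simp: O_bis_def)
  ultimately show ?thesis
    unfolding tau_bis_fin_def topology_generated_by_topspace
    by blast
qed

lemma bisim_k_sym: "bisim_k T1 T2 k x y \<longleftrightarrow> bisim_k T2 T1 k y x"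
proof (induction k arbitrary: x y)
  case (Suc k)
  show ?case unfolding bisim_k.simps Suc.IH by blast
qed simp

lemma bisim_k_trans:
  "bisim_k T1 T2 k x y \<Longrightarrow> bisim_k T2 T3 k y z \<Longrightarrow> bisim_k T1 T3 k x z"
proof (induction k arbitrary: x y z)
  case (Suc k)
  note xy = Suc.prems(1)[unfolded bisim_k.simps] and yz = Suc.prems(2)[unfolded bisim_k.simps]
  show ?case
    unfolding bisim_k.simps
  proof (intro conjI allI impI)
    fix a x' assume "(x, a, x') \<in> T1"
    then obtain y' where y': "(y, a, y') \<in> T2" "bisim_k T1 T2 k x' y'" using xy by blast
    then obtain z' where "(z, a, z') \<in> T3" "bisim_k T2 T3 k y' z'" using yz by blast
    then show "\<exists>z'. (z, a, z') \<in> T3 \<and> bisim_k T1 T3 k x' z'" using Suc.IH y' by blast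
  next
    fix a z' assume "(z, a, z') \<in> T3"
    then obtain y' where y': "(y, a, y') \<in> T2" "bisim_k T2 T3 k y' z'" using yz by blast
    then obtain x' where "(x, a, x') \<in> T1" "bisim_k T1 T2 k x' y'" using xy by blast
    then show "\<exists>x'. (x, a, x') \<in> T1 \<and> bisim_k T1 T3 k x' z'" using Suc.IH y' by blast
  qed
qed simp

lemma bisim_k_mono: "bisim_k T1 T2 m x y \<Longrightarrow> k \<le> m \<Longrightarrow> bisim_k T1 T2 k x y"
proof (induction k arbitrary: m x y)
  case (Suc k)
  then obtain n where n: "m = Suc n" "k \<le> n" by (cases m) auto
  from Suc.prems(1) show ?case unfolding n bisim_k.simps by (meson Suc.IH n(2))
qed simp

lemma ProcF_finite_sum:
  assumes "finite S" "S \<subseteq> Act \<times> ProcF Act"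
  shows "\<exists>q\<in>ProcF Act. \<forall>a q'. (q, a, q') \<in> transF \<longleftrightarrow> (a, q') \<in> S"
  using assms
proof (induction S)
  case empty
  show ?case by (intro bexI[of _ Stop]) (auto simp: transF_iff[of Stop] intro: ProcF.intros)
next
  case (insert x S)
  obtain b r where x: "x = (b, r)" by force
  obtain q where q: "q \<in> ProcF Act" "\<forall>a q'. (q, a, q') \<in> transF \<longleftrightarrow> (a, q') \<in> S"
    using insert by auto
  show ?case
    using q insert.prems
    by (intro bexI[of _ "Plus (Pre b r) q"])
      (auto simp: x transF_iff[of "Plus (Pre b r) q"] transF_iff[of "Pre b r"] intro: ProcF.intros)
qed

lemma finite_bisim_k_representatives:
  assumes "lts Proc Act Tr" "finite Act"
  shows "\<exists>C. finite C \<and> C \<subseteq> ProcF Act \<and> (\<forall>p\<in>Proc. \<exists>q\<in>C. bisim_k transF Tr k q p)"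
proof (induction k)
  case 0
  show ?case by (intro exI[of _ "{Stop}"]) (auto intro: ProcF.intros)
next
  case (Suc k)
  then obtain C where C: "finite C" "C \<subseteq> ProcF Act"
    "\<forall>p\<in>Proc. \<exists>q\<in>C. bisim_k transF Tr k q p" by blast
  have "\<forall>S\<in>Pow (Act \<times> C). \<exists>q\<in>ProcF Act. \<forall>a q'. (q, a, q') \<in> transF \<longleftrightarrow> (a, q') \<in> S"
  proof
    fix S assume "S \<in> Pow (Act \<times> C)"
    then have S: "S \<subseteq> Act \<times> C" by simp
    then have "finite S" by (rule finite_subset) (simp add: C(1) assms(2))
    moreover have "S \<subseteq> Act \<times> ProcF Act" using S C(2) by blast
    ultimately show "\<exists>q\<in>ProcF Act. \<forall>a q'. (q, a, q') \<in> transF \<longleftrightarrow> (a, q') \<in> S"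
      by (rule ProcF_finite_sum)
  qed
  then obtain f where f0: "\<forall>S\<in>Pow (Act \<times> C). f S \<in> ProcF Act \<and>
      (\<forall>a q'. (f S, a, q') \<in> transF \<longleftrightarrow> (a, q') \<in> S)"
    unfolding Bex_def by (rule bchoice[THEN exE]) blast
  have f: "f S \<in> ProcF Act" "(f S, a, q') \<in> transF \<longleftrightarrow> (a, q') \<in> S"
    if "S \<subseteq> Act \<times> C" for S a q'
    using f0 that by auto
  show ?case
  proof (intro exI[of _ "f ` Pow (Act \<times> C)"] conjI ballI)
    show "finite (f ` Pow (Act \<times> C))" using C(1) assms(2) by simp
    show "f ` Pow (Act \<times> C) \<subseteq> ProcF Act" using f(1) by auto
    fix p assume p: "p \<in> Proc"
    define S where
      "S = {(a, q). a \<in> Act \<and> q \<in> C \<and> (\<exists>p'. (p, a, p') \<in> Tr \<and> bisim_k transF Tr k q p')}"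
    have S: "S \<subseteq> Act \<times> C" by (auto simp: S_def)
    have "bisim_k transF Tr (Suc k) (f S) p"
      unfolding bisim_k.simps f(2)[OF S]
    proof (intro conjI allI impI)
      fix a q' assume "(a, q') \<in> S"
      then show "\<exists>y'. (p, a, y') \<in> Tr \<and> bisim_k transF Tr k q' y'" by (auto simp: S_def)
    next
      fix a p' assume t: "(p, a, p') \<in> Tr"
      then have "a \<in> Act" "p' \<in> Proc" using assms(1) by (auto simp: lts_def)
      with t C(3) show "\<exists>x'. (a, x') \<in> S \<and> bisim_k transF Tr k x' p'"
        unfolding S_def by blast
    qed
    then show "\<exists>q\<in>f ` Pow (Act \<times> C). bisim_k transF Tr (Suc k) q p" using S by blast
  qed
qed

lemma openin_tau_bis_fin:
  assumes "lts Proc Act Tr" "finite Act"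
  shows "openin (tau_bis_fin Proc Act Tr) U \<longleftrightarrow>
     (\<exists>\<F>\<subseteq>{O_bis Proc Tr k q | q k. q \<in> ProcF Act}. U = \<Union>\<F>)"
  unfolding tau_bis_fin_def
proof (rule openin_generated_by_basis)
  fix A B x
  assume "A \<in> {O_bis Proc Tr k q | q k. q \<in> ProcF Act}"
    "B \<in> {O_bis Proc Tr k q | q k. q \<in> ProcF Act}" and x: "x \<in> A" "x \<in> B"
  then obtain q1 k1 q2 k2 where q: "A = O_bis Proc Tr k1 q1" "B = O_bis Proc Tr k2 q2"
    by blast
  define m where "m = max k1 k2"
  have "x \<in> Proc" using x q by (auto simp: O_bis_def)
  then obtain r where r: "r \<in> ProcF Act" "bisim_k transF Tr m r x"
    using finite_bisim_k_representatives[OF assms] by blast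
  have "bisim_k transF Tr k q' p"
    if "bisim_k transF Tr k q' x" "bisim_k transF Tr m r p" "k \<le> m" for k q' p
    using that r(2) bisim_k_sym bisim_k_trans bisim_k_mono by metis
  then have "O_bis Proc Tr m r \<subseteq> A \<inter> B"
    using x by (auto simp: q O_bis_def m_def)
  moreover have "x \<in> O_bis Proc Tr m r" using r \<open>x \<in> Proc\<close> by (simp add: O_bis_def)
  ultimately show "\<exists>C\<in>{O_bis Proc Tr k q | q k. q \<in> ProcF Act}. x \<in> C \<and> C \<subseteq> A \<inter> B"
    using r(1) by blast
qed

end

theory Submission
  imports Defs
begin

text \<open>Being deadlocked is invariant under \<open>\<sim>\<^sub>1\<close>, and over a finite alphabet every set
  of processes that is invariant under some \<open>\<sim>\<^sub>k\<close> is open in the finite-depth bisimulation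
  topology, because every process is \<open>\<sim>\<^sub>k\<close> to a finite one. On the other hand, a finite process
  simulated by a deadlocked one has no transitions, so it is simulated by every process: the only
  neighbourhood of a deadlocked process in the simulation topology is the whole space.\<close>

lemma openin_tau_bis_fin_if_bisim_k_invariant:
  assumes "lts Proc Act Tr" "finite Act" "U \<subseteq> Proc"
    and inv: "\<And>p p'. p \<in> U \<Longrightarrow> p' \<in> Proc \<Longrightarrow> bisim_k Tr Tr k p p' \<Longrightarrow> p' \<in> U"
  shows "openin (tau_bis_fin Proc Act Tr) U"
proof (subst openin_subopen, intro ballI)
  fix p assume p: "p \<in> U"
  then obtain q where q: "q \<in> ProcF Act" "bisim_k transF Tr k q p"
    using finite_bisim_k_representatives[OF assms(1,2)] assms(3) by blast
  have "openin (tau_bis_fin Proc Act Tr) (O_bis Proc Tr k q)"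
    unfolding tau_bis_fin_def using q(1) by (intro topology_generated_by_Basis) blast
  moreover have "p \<in> O_bis Proc Tr k q" using p q(2) assms(3) by (auto simp: O_bis_def)
  moreover have "O_bis Proc Tr k q \<subseteq> U"
  proof
    fix p' assume "p' \<in> O_bis Proc Tr k q"
    then have "p' \<in> Proc" "bisim_k transF Tr k q p'" by (simp_all add: O_bis_def)
    \<comment> \<open>The finite process \<open>q\<close> links two states of \<open>Proc\<close>:
      symmetry and transitivity turn \<open>q\<close>'s relation to both into
      \<open>bisim_k Tr Tr k p p'\<close>.\<close>
    moreover have "bisim_k Tr transF k p q" using q(2) by (rule bisim_k_sym[THEN iffD1])
    ultimately show "p' \<in> U" using inv[OF p] bisim_k_trans by metis
  qed
  ultimately show "\<exists>V. openin (tau_bis_fin Proc Act Tr) V \<and> p \<in> V \<and> V \<subseteq> U" by blast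
qed

text \<open>A single round of matching already forces equal sets of initial actions.\<close>

lemma bisim_k_Suc_deadlocked_iff:
  assumes "bisim_k T1 T2 (Suc k) x y"
  shows "deadlocked T1 x \<longleftrightarrow> deadlocked T2 y"
proof -
  have "(\<exists>x'. (x, a, x') \<in> T1) \<longleftrightarrow> (\<exists>y'. (y, a, y') \<in> T2)" for a
    using assms unfolding bisim_k.simps by meson
  then show ?thesis by (simp add: deadlocked_def initials_def)
qed

lemma O_sim_eq_Proc_if_deadlocked:
  assumes "p \<in> O_sim Proc Act Tr q" "deadlocked Tr p"
  shows "O_sim Proc Act Tr q = Proc"
proof -
  \<comment> \<open>A move of \<open>q\<close> would have to be matched by the deadlocked
    \<open>p\<close>.\<close>
  have "q \<in> ProcF Act" "\<And>a q'. (q, a, q') \<notin> transF"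
    using assms simulated_by_iff[of Proc Act Tr q p]
    unfolding O_sim_def deadlocked_def initials_def by blast+
  then have "simulated_by Proc Act Tr q p'" if "p' \<in> Proc" for p'
    using that by (subst simulated_by_iff) blast
  then show ?thesis by (auto simp: O_sim_def)
qed

lemma openin_tau_sim_deadlocked:
  assumes "openin (tau_sim Proc Act Tr) U" "p \<in> U" "deadlocked Tr p"
  shows "U = Proc"
proof
  show "U \<subseteq> Proc" using openin_subset[OF assms(1)] by (simp add: topspace_tau_sim)
  \<comment> \<open>The sets \<open>O_sim\<close> form a basis, so a single one of them fits between
    \<open>p\<close> and \<open>U\<close>.\<close>
  obtain q where "p \<in> O_sim Proc Act Tr q" "O_sim Proc Act Tr q \<subseteq> U"
    using assms(1,2) unfolding openin_tau_sim by blast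
  then show "Proc \<subseteq> U" using O_sim_eq_Proc_if_deadlocked[OF _ assms(3)] by metis
qed

theorem proposition5p23:
  fixes Proc :: "'s set" and Act :: "'a set" and Tr :: "('s \<times> 'a \<times> 's) set"
  assumes "lts Proc Act Tr"
    and "finite Act" and "Act \<noteq> {}"
    and "\<exists>p\<in>Proc. deadlocked Tr p"
    and "\<exists>p\<in>Proc. \<not> deadlocked Tr p"
  shows "openin (tau_bis_fin Proc Act Tr) (deadlocked_set Proc Tr) \<and>
    openin (tau_bis_fin Proc Act Tr) (Proc - deadlocked_set Proc Tr) \<and>
    closedin (tau_bis_fin Proc Act Tr) (deadlocked_set Proc Tr) \<and>
    \<not> openin (tau_sim Proc Act Tr) (deadlocked_set Proc Tr) \<and>
    tau_bis_fin Proc Act Tr \<noteq> tau_sim Proc Act Tr"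
proof -
  let ?D = "deadlocked_set Proc Tr"
  have sub: "?D \<subseteq> Proc" by (auto simp: deadlocked_set_def)
  have D: "openin (tau_bis_fin Proc Act Tr) ?D"
    \<comment> \<open>Level 1 is the least that can detect deadlock, as level 0 relates
      everything.\<close>
    by (rule openin_tau_bis_fin_if_bisim_k_invariant[OF assms(1,2) sub, where k = "Suc 0"])
      (auto simp: deadlocked_set_def simp del: bisim_k.simps dest: bisim_k_Suc_deadlocked_iff)
  have C: "openin (tau_bis_fin Proc Act Tr) (Proc - ?D)"
    by (rule openin_tau_bis_fin_if_bisim_k_invariant[OF assms(1,2) Diff_subset, where k = "Suc 0"])
      (auto simp: deadlocked_set_def simp del: bisim_k.simps dest: bisim_k_Suc_deadlocked_iff)
  have "closedin (tau_bis_fin Proc Act Tr) ?D"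
    using C sub by (simp add: closedin_def topspace_tau_bis_fin)
  moreover have S: "\<not> openin (tau_sim Proc Act Tr) ?D"
    \<comment> \<open>If open, \<open>?D\<close> would be all of \<open>Proc\<close>, contradicting
      the existence of a non-deadlocked process.\<close>
    using openin_tau_sim_deadlocked[of Proc Act Tr ?D] assms(4,5)
    by (auto simp: deadlocked_set_def)
  moreover have "tau_bis_fin Proc Act Tr \<noteq> tau_sim Proc Act Tr" using D S by auto
  ultimately show ?thesis using D C by blast
qed

end
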